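(* Let $d\ge1$, $\varrho>0$ and $\beta,\gamma,\mu>-\tfrac12$. For $n=0,1,2,\ldots$ and $(x,t),(y,s)\in{}_\varrho\mathbb V^{d+1}$, the reproducing kernel ${}_\varrho\mathbf P_n^E(W_{\beta,\gamma,\mu})$ on the solid double hyperboloid and the reproducing kernel $\mathbf P_n^E(W_{\beta,\gamma,\mu})$ on the solid double cone satisfy $${}_\varrho\mathbf P_n^E\big(W_{\beta,\gamma,\mu};(x,t),(y,s)\big)=\mathbf P_n^E\Big(W_{\beta,\gamma,\mu};\big(x,\sqrt{t^2-\varrho^2}\big),\big(y,\sqrt{s^2-\varrho^2}\big)\Big).$$
   Context: For $\varrho\ge0$, ${}_\varrho\mathbb V^{d+1}=\{(x,t)\in\mathbb R^d\times\mathbb R:\ \|x\|^2\le t^2-\varrho^2,\ \varrho\le|t|\le\sqrt{\varrho^2+1}\}$ (solid double hyperboloid if $\varrho>0$, solid double cone if $\varrho=0$), with weight $$W_{\beta,\gamma,\mu}(x,t)=|t|(t^2-\varrho^2)^{\beta-\frac12}(\varrho^2+1-t^2)^{\gamma-\frac12}(t^2-\varrho^2-\|x\|^2)^{\mu-\frac12}.$$ The inner product is $\langle f,g\rangle=b\int f\,g\,W_{\beta,\gamma,\mu}\,dx\,dt$ over ${}_\varrho\mathbb V^{d+1}$, with $b$ chosen so that $\langle1,1\rangle=1$. For each $\varrho\ge 0$, $\mathcal V_n^E({}_\varrho\mathbb V^{d+1},W_{\beta,\gamma,\mu})$ is the space of polynomials in $(x,t)$ of degree at most $n$ that are even in $t$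 and orthogonal to all polynomials of degree at most $n-1$. Its reproducing kernel with respect to $\langle\cdot,\cdot\rangle$ is denoted ${}_\varrho\mathbf P_n^E(W_{\beta,\gamma,\mu};\cdot,\cdot)$ for $\varrho>0$ and $\mathbf P_n^E(W_{\beta,\gamma,\mu};\cdot,\cdot)$ for $\varrho=0$. *)

theory Defs
  imports "HOL-Analysis.Analysis"
begin

text \<open>
  Points of d+1 dimensional space are pairs \<open>(x, t) :: (real ^ 'd) \<times> real\<close>, where d is
  \<open>CARD('d) \<ge> 1\<close>.  For \<open>\<rho> = 0\<close> the following set is the solid double cone.
\<close>

definition solid_hyperboloid :: "real \<Rightarrow> ((real ^ 'd) \<times> real) set" where
  "solid_hyperboloid \<rho> =
     {(x, t). (norm x)\<^sup>2 \<le> t\<^sup>2 - \<rho>\<^sup>2 \<and> \<rho> \<le> \<bar>t\<bar> \<and> \<bar>t\<bar> \<le> sqrt (\<rho>\<^sup>2 + 1)}"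

definition weight :: "real \<Rightarrow> real \<Rightarrow> real \<Rightarrow> real \<Rightarrow> (real ^ 'd) \<times> real \<Rightarrow> real" where
  "weight \<rho> \<beta> \<gamma> \<mu> = (\<lambda>(x, t).
     \<bar>t\<bar> * (t\<^sup>2 - \<rho>\<^sup>2) powr (\<beta> - 1/2) * (\<rho>\<^sup>2 + 1 - t\<^sup>2) powr (\<gamma> - 1/2)
       * (t\<^sup>2 - \<rho>\<^sup>2 - (norm x)\<^sup>2) powr (\<mu> - 1/2))"

text \<open>
  The factor in front is the constant b with \<open>\<langle>1,1\<rangle> = 1\<close>.  It exists iff the weight is
  integrable, which for \<open>\<beta>, \<gamma>, \<mu> > -1/2\<close> amounts to \<open>2\<beta> + 2\<mu> + d > 0\<close>; this is automatic for
  \<open>d \<ge> 2\<close> but can fail for \<open>d = 1\<close>, in which case the form below is identically 0.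
\<close>

definition inner_W :: "real \<Rightarrow> real \<Rightarrow> real \<Rightarrow> real
    \<Rightarrow> ((real ^ 'd) \<times> real \<Rightarrow> real) \<Rightarrow> ((real ^ 'd) \<times> real \<Rightarrow> real) \<Rightarrow> real" where
  "inner_W \<rho> \<beta> \<gamma> \<mu> f g =
     1 / (LINT p:(solid_hyperboloid \<rho> :: ((real ^ 'd) \<times> real) set)|lborel. weight \<rho> \<beta> \<gamma> \<mu> p)
       * (LINT p:solid_hyperboloid \<rho>|lborel. f p * g p * weight \<rho> \<beta> \<gamma> \<mu> p)"

definition monomial :: "('d::finite \<Rightarrow> nat) \<times> nat \<Rightarrow> (real ^ 'd) \<times> real \<Rightarrow> real" where
  "monomial = (\<lambda>(a, k) (x, t). (\<Prod>i\<in>UNIV. (x $ i) ^ a i) * t ^ k)"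

text \<open>
  Polynomials are identified with the functions they define on the whole space; the index set
  of exponents is finite.
\<close>

definition poly_deg_le :: "nat \<Rightarrow> ((real ^ 'd) \<times> real \<Rightarrow> real) set" where
  "poly_deg_le n =
     {f. \<exists>c. f = (\<lambda>p. \<Sum>m\<in>{(a, k). (\<Sum>i\<in>UNIV. a i) + k \<le> n}. c m * monomial m p)}"

text \<open>
  Orthogonality to degree at most \<open>n - 1\<close> is expressed by \<open>m < n\<close>, hence is void for \<open>n = 0\<close>.
\<close>

definition V_even :: "nat \<Rightarrow> real \<Rightarrow> real \<Rightarrow> real \<Rightarrow> real
    \<Rightarrow> ((real ^ 'd) \<times> real \<Rightarrow> real) set" where
  "V_even n \<rho> \<beta> \<gamma> \<mu> =
     {f \<in> poly_deg_le n. (\<forall>x t. f (x, - t) = f (x, t)) \<and>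
        (\<forall>m<n. \<forall>g\<in>poly_deg_le m. inner_W \<rho> \<beta> \<gamma> \<mu> f g = 0)}"

definition is_reproducing_kernel ::
    "(('a \<Rightarrow> real) \<Rightarrow> ('a \<Rightarrow> real) \<Rightarrow> real) \<Rightarrow> ('a \<Rightarrow> real) set \<Rightarrow> ('a \<Rightarrow> 'a \<Rightarrow> real) \<Rightarrow> bool" where
  "is_reproducing_kernel ip V K \<longleftrightarrow> (\<forall>p. K p \<in> V \<and> (\<forall>f\<in>V. ip f (K p) = f p))"

text \<open>
  The value at \<open>(p, q)\<close> of the reproducing kernel.  Since the members of \<open>V_even\<close> are polynomials
  on the whole space, the kernel is determined there, not only on the hyperboloid.  The description
  ranges over the value rather than over the kernel so that, when the weight is not integrable
  and no kernel exists, all values are the same unspecified real.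
\<close>

definition kernel_even :: "nat \<Rightarrow> real \<Rightarrow> real \<Rightarrow> real \<Rightarrow> real
    \<Rightarrow> (real ^ 'd) \<times> real \<Rightarrow> (real ^ 'd) \<times> real \<Rightarrow> real" where
  "kernel_even n \<rho> \<beta> \<gamma> \<mu> p q =
     (THE r. \<exists>K. is_reproducing_kernel (inner_W \<rho> \<beta> \<gamma> \<mu>) (V_even n \<rho> \<beta> \<gamma> \<mu>) K \<and> r = K p q)"

end

theory Submission
  imports Defs
begin

text \<open>
  A polynomial that is even in \<open>t\<close> has the form \<open>F (x, t\<^sup>2 - \<rho>\<^sup>2)\<close>, and the substitution \<open>u = t\<^sup>2 - \<rho>\<^sup>2\<close>,
  \<open>du = 2 t dt\<close> on each half \<open>\<plusminus>t > 0\<close> carries the weight to a measure in \<open>(x, u)\<close> that does not depend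
  on \<open>\<rho>\<close>.  Hence even polynomials with a common profile \<open>F\<close> for two parameters \<open>\<rho>\<close>, \<open>\<sigma>\<close> have equal inner
  products, and a representer of the evaluation at \<open>(x, t)\<close> corresponds to a representer of the evaluation
  at \<open>(x, s)\<close> whenever \<open>t\<^sup>2 - \<rho>\<^sup>2 = s\<^sup>2 - \<sigma>\<^sup>2\<close>.  Existence of a kernel is not needed: the sets of
  values of reproducing kernels for the two parameters agree, possibly as empty sets.
\<close>

subsection \<open>Polynomials and their profiles\<close>

text \<open>Sums over an infinite index set are 0 by convention, so the sums in
  \<open>poly_deg_le\<close> have their intended meaning only by this fact.\<close>

lemma finite_exponents: "finite {(a :: 'd::finite \<Rightarrow> nat, k). (\<Sum>i\<in>UNIV. a i) + k \<le> n}"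
proof (rule finite_subset)
  show "{(a :: 'd \<Rightarrow> nat, k). (\<Sum>i\<in>UNIV. a i) + k \<le> n} \<subseteq> (UNIV \<rightarrow>\<^sub>E {..n}) \<times> {..n}"
  proof (rule subsetI)
    fix m :: "('d \<Rightarrow> nat) \<times> nat" assume "m \<in> {(a, k). (\<Sum>i\<in>UNIV. a i) + k \<le> n}"
    then obtain a k where m: "m = (a, k)" and le: "(\<Sum>i\<in>UNIV. a i) + k \<le> n" by blast
    have "a i \<le> n" for i
      using member_le_sum[of i UNIV a] le by simp
    with m le show "m \<in> (UNIV \<rightarrow>\<^sub>E {..n}) \<times> {..n}" by auto
  qed
qed (auto intro!: finite_PiE)

lemma monomial_in_poly_deg_le:
  assumes "(\<Sum>i\<in>UNIV. a i) + k \<le> n"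
  shows "monomial (a, k) \<in> poly_deg_le n"
proof -
  have "monomial (a, k) p = (\<Sum>m\<in>{(a, k). (\<Sum>i\<in>UNIV. a i) + k \<le> n}. of_bool (m = (a, k)) * monomial m p)" for p
    using assms finite_exponents by (subst sum.remove[of _ "(a, k)"]) (auto intro!: sum.neutral)
  then show ?thesis
    unfolding poly_deg_le_def mem_Collect_eq by (intro exI[of _ "\<lambda>m. of_bool (m = (a, k))"] ext)
qed

lemma poly_deg_le_add:
  assumes "f \<in> poly_deg_le n" "g \<in> poly_deg_le n"
  shows "(\<lambda>p. f p + g p) \<in> poly_deg_le n"
proof -
  obtain c d where "f = (\<lambda>p. \<Sum>m\<in>{(a, k). (\<Sum>i\<in>UNIV. a i) + k \<le> n}. c m * monomial m p)"
    "g = (\<lambda>p. \<Sum>m\<in>{(a, k). (\<Sum>i\<in>UNIV. a i) + k \<le> n}. d m * monomial m p)"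
    using assms unfolding poly_deg_le_def by blast
  then show ?thesis
    unfolding poly_deg_le_def mem_Collect_eq
    by (intro exI[of _ "\<lambda>m. c m + d m"]) (simp add: sum.distrib algebra_simps)
qed

lemma poly_deg_le_cmult:
  assumes "f \<in> poly_deg_le n"
  shows "(\<lambda>p. r * f p) \<in> poly_deg_le n"
proof -
  obtain c where "f = (\<lambda>p. \<Sum>m\<in>{(a, k). (\<Sum>i\<in>UNIV. a i) + k \<le> n}. c m * monomial m p)"
    using assms unfolding poly_deg_le_def by blast
  then show ?thesis
    unfolding poly_deg_le_def mem_Collect_eq
    by (intro exI[of _ "\<lambda>m. r * c m"]) (simp add: sum_distrib_left mult.assoc)
qed

lemma poly_deg_le_sum:
  assumes "\<And>i. i \<in> I \<Longrightarrow> f i \<in> poly_deg_le n"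
  shows "(\<lambda>p. \<Sum>i\<in>I. f i p) \<in> poly_deg_le n"
proof -
  \<comment> \<open>The zero polynomial, which is the sum over an empty or an infinite index
    set.\<close>
  have "(\<lambda>p. 0 * monomial (\<lambda>_. 0, 0) p) \<in> poly_deg_le n"
    by (intro poly_deg_le_cmult monomial_in_poly_deg_le) simp
  with assms show ?thesis
    by (induction I rule: infinite_finite_induct) (auto intro: poly_deg_le_add)
qed

lemma continuous_on_poly_deg_le: "f \<in> poly_deg_le n \<Longrightarrow> continuous_on S f"
  unfolding poly_deg_le_def monomial_def
  by (auto simp: case_prod_unfold intro!: continuous_intros)

lemma borel_measurable_poly_deg_le: "f \<in> poly_deg_le n \<Longrightarrow> f \<in> borel_measurable borel"
  by (intro borel_measurable_continuous_onI continuous_on_poly_deg_le)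

lemma monomial_reflect: "monomial m (x, - t) = (- 1) ^ snd m * monomial m (x, t)"
  by (cases m, cases "even (snd m)") (simp_all add: monomial_def)

lemma poly_deg_le_reflect:
  assumes "f \<in> poly_deg_le n"
  shows "(\<lambda>(x, t). f (x, - t)) \<in> poly_deg_le n"
proof -
  obtain c where "f = (\<lambda>p. \<Sum>m\<in>{(a, k). (\<Sum>i\<in>UNIV. a i) + k \<le> n}. c m * monomial m p)"
    using assms unfolding poly_deg_le_def by blast
  then show ?thesis
    unfolding poly_deg_le_def mem_Collect_eq
    by (intro exI[of _ "\<lambda>m. (- 1) ^ snd m * c m"])
       (simp add: fun_eq_iff monomial_reflect mult_ac)
qed

section \<open>Even functions and common profiles\<close>

definition even_in_t :: "('a \<times> real \<Rightarrow> real) \<Rightarrow> bool" where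
  "even_in_t f \<longleftrightarrow> (\<forall>x t. f (x, - t) = f (x, t))"

text \<open>At the values attained by both \<open>t\<^sup>2 - \<rho>\<^sup>2\<close> and
  \<open>s\<^sup>2 - \<sigma>\<^sup>2\<close>, \<open>f\<close> and \<open>g\<close> are one
  function \<open>F\<close> of \<open>x\<close> and this value; the relation avoids naming
  \<open>F\<close>.\<close>

definition same_profile :: "real \<Rightarrow> real \<Rightarrow> ('a \<times> real \<Rightarrow> real) \<Rightarrow> ('a \<times> real \<Rightarrow> real) \<Rightarrow> bool" where
  "same_profile \<rho> \<sigma> f g \<longleftrightarrow> (\<forall>x t s. t\<^sup>2 - \<rho>\<^sup>2 = s\<^sup>2 - \<sigma>\<^sup>2 \<longrightarrow> f (x, t) = g (x, s))"

lemma same_profile_sym: "same_profile \<rho> \<sigma> f g \<longleftrightarrow> same_profile \<sigma> \<rho> g f"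
  unfolding same_profile_def by metis

lemma even_in_t_abs: "even_in_t f \<Longrightarrow> f (x, \<bar>t\<bar>) = f (x, t)"
  by (auto simp: even_in_t_def abs_if)

text \<open>In even powers of \<open>t\<close>, replace \<open>t\<^sup>2\<close> by
  \<open>s\<^sup>2 + (\<rho>\<^sup>2 - \<sigma>\<^sup>2)\<close>. The shift is constant, so the
  degree does not grow.\<close>

lemma ex_same_profile:
  fixes f :: "(real ^ 'd) \<times> real \<Rightarrow> real"
  assumes f: "f \<in> poly_deg_le n" "even_in_t f"
  obtains g where "g \<in> poly_deg_le n" "even_in_t g" "same_profile \<rho> \<sigma> f g"
proof -
  define I where "I = {(a :: 'd \<Rightarrow> nat, k). (\<Sum>i\<in>UNIV. a i) + k \<le> n}"
  obtain c where c: "f = (\<lambda>p. \<Sum>m\<in>I. c m * monomial m p)"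
    using f unfolding poly_deg_le_def I_def by blast
  \<comment> \<open>The monomial \<open>m\<close> after this replacement. It is faithful for even
    exponents; the odd ones, which \<open>div\<close> rounds down, are dropped in
    \<open>g\<close>.\<close>
  define h where "h m = (\<lambda>(x :: real ^ 'd, s). (\<Prod>i\<in>UNIV. (x $ i) ^ fst m i) * (s\<^sup>2 + (\<rho>\<^sup>2 - \<sigma>\<^sup>2)) ^ (snd m div 2))"
    for m :: "('d \<Rightarrow> nat) \<times> nat"
  define g where "g p = (\<Sum>m\<in>I. of_bool (even (snd m)) * c m * h m p)" for p
  have h: "h m \<in> poly_deg_le n" if "m \<in> I" for m
  proof -
    have "h m = (\<lambda>p. \<Sum>j\<le>snd m div 2. of_nat (snd m div 2 choose j) * (\<rho>\<^sup>2 - \<sigma>\<^sup>2) ^ (snd m div 2 - j)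
        * monomial (fst m, 2 * j) p)"
      by (auto simp: h_def fun_eq_iff monomial_def binomial_ring sum_distrib_left power_mult power_commutes power2_eq_square power_mult_distrib mult_ac)
    moreover have "\<dots> \<in> poly_deg_le n"
      using that by (intro poly_deg_le_sum poly_deg_le_cmult monomial_in_poly_deg_le) (auto simp: I_def)
    ultimately show ?thesis by simp
  qed
  show thesis
  proof
    show "g \<in> poly_deg_le n"
      unfolding g_def by (intro poly_deg_le_sum poly_deg_le_cmult h)
    show "even_in_t g"
      by (simp add: even_in_t_def g_def h_def)
    show "same_profile \<rho> \<sigma> f g"
      unfolding same_profile_def
    proof (intro allI impI)
      fix x t s assume "t\<^sup>2 - \<rho>\<^sup>2 = s\<^sup>2 - \<sigma>\<^sup>2"
      then have t: "s\<^sup>2 + (\<rho>\<^sup>2 - \<sigma>\<^sup>2) = t\<^sup>2" by simp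
      \<comment> \<open>Evenness is known of the function, not of the coefficients \<open>c\<close>;
        averaging over \<open>t\<close> and \<open>- t\<close> cancels the odd terms whatever their
        coefficients.\<close>
      have "f (x, t) = (f (x, t) + f (x, - t)) / 2"
        using f(2) by (simp add: even_in_t_def)
      also have "\<dots> = (\<Sum>m\<in>I. (c m * monomial m (x, t) + c m * monomial m (x, - t)) / 2)"
        by (simp add: c sum.distrib add_divide_distrib sum_divide_distrib)
      also have "\<dots> = g (x, s)"
        unfolding g_def h_def by (intro sum.cong) (auto simp: t monomial_def power_mult[symmetric])
      finally show "f (x, t) = g (x, s)" .
    qed
  qed
qed

section \<open>Extrapolation in \<open>t\<close>\<close>

text \<open>\<open>l w\<close> is the value at \<open>u\<close> of the Lagrange basis polynomial of
  the node \<open>w\<close>, hence the same for all \<open>p\<close>.\<close>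

lemma Lagrange_interpolation:
  fixes T :: "real set"
  assumes "finite T"
  obtains l where "\<And>p. degree p < card T \<Longrightarrow> poly p u = (\<Sum>w\<in>T. l w * poly p w)"
proof
  \<comment> \<open>The basis polynomial with linear factors (X - v) / (w - v).\<close>
  define b where "b w = (\<Prod>v\<in>T - {w}. [:- v / (w - v), 1 / (w - v):])" for w
  have b: "poly (b w) v = of_bool (v = w)" if "v \<in> T" "w \<in> T" for v w
  proof (cases "v = w")
    case True
    have "- (u / (w - u)) + w / (w - u) = 1" if "u \<noteq> w" for u
      using that by (simp flip: add_divide_distrib diff_divide_distrib)
    with True show ?thesis
      by (auto simp: b_def poly_prod intro!: prod.neutral)
  next
    case False
    with that assms show ?thesis
      by (auto simp: b_def poly_prod intro!: bexI[of _ v])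
  qed
  have deg_b: "degree (b w) < card T" if "w \<in> T" for w
  proof -
    have "degree (b w) \<le> (\<Sum>v\<in>T - {w}. 1)"
      unfolding b_def using assms
      by (intro order_trans[OF degree_prod_sum_le] sum_mono) (simp_all add: assms)
    also have "\<dots> < card T"
      using card_Diff1_less[OF assms that] by simp
    finally show ?thesis .
  qed
  fix p :: "real poly" assume deg: "degree p < card T"
  \<comment> \<open>Both sides have degree below \<open>card T\<close> and agree on
    \<open>T\<close>.\<close>
  have "p = (\<Sum>w\<in>T. smult (poly p w) (b w))"
  proof (rule poly_eqI_degree)
    show "poly p v = poly (\<Sum>w\<in>T. smult (poly p w) (b w)) v" if "v \<in> T" for v
    proof -
      have "poly (\<Sum>w\<in>T. smult (poly p w) (b w)) v = (\<Sum>w\<in>T. if w = v then poly p w else 0)"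
        using that by (auto simp: poly_sum b intro!: sum.cong)
      with that assms show ?thesis by simp
    qed
    show "degree (\<Sum>w\<in>T. smult (poly p w) (b w)) < card T"
      using deg le_less_trans[OF degree_smult_le deg_b] by (intro degree_sum_less) simp_all
  qed fact
  then have "poly p u = poly (\<Sum>w\<in>T. smult (poly p w) (b w)) u" by simp
  then show "poly p u = (\<Sum>w\<in>T. poly (b w) u * poly p w)"
    by (simp add: poly_sum mult.commute)
qed

lemma poly_deg_le_section:
  fixes f :: "(real ^ 'd) \<times> real \<Rightarrow> real"
  assumes "f \<in> poly_deg_le n"
  obtains q where "degree q \<le> n" "\<And>t. f (x, t) = poly q t"
proof -
  define I where "I = {(a :: 'd \<Rightarrow> nat, k). (\<Sum>i\<in>UNIV. a i) + k \<le> n}"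
  obtain c where c: "f = (\<lambda>p. \<Sum>m\<in>I. c m * monomial m p)"
    using assms unfolding poly_deg_le_def I_def by blast
  show thesis
  proof
    show "degree (\<Sum>m\<in>I. monom (c m * (\<Prod>i\<in>UNIV. (x $ i) ^ fst m i)) (snd m)) \<le> n"
      using finite_exponents unfolding I_def
      by (intro degree_sum_le) (auto intro!: order_trans[OF degree_monom_le])
    show "f (x, t) = poly (\<Sum>m\<in>I. monom (c m * (\<Prod>i\<in>UNIV. (x $ i) ^ fst m i)) (snd m)) t" for t
      by (auto simp: c poly_sum poly_monom monomial_def mult_ac intro!: sum.cong)
  qed
qed

text \<open>In \<open>t\<close> alone \<open>f\<close> has degree at most \<open>n\<close>, so its
  values at the \<open>n + 1\<close> nodes \<open>r\<close>, ..., \<open>r + n\<close> determine it.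
  Since \<open>l\<close> serves all \<open>f\<close> and \<open>x\<close>, any evaluation is a fixed
  combination of evaluations at heights at least \<open>r\<close>.\<close>

lemma poly_deg_le_extrapolation:
  fixes t r :: real
  obtains l and T :: "real set" where "\<forall>w\<in>T. r \<le> w"
    "\<And>f x. f \<in> poly_deg_le n \<Longrightarrow> f (x, t) = (\<Sum>w\<in>T. l w * f (x, w))"
proof -
  define T where "T = (\<lambda>j. r + real j) ` {..n}"
  have T: "finite T" "card T = Suc n"
    by (auto simp: T_def card_image inj_on_def)
  obtain l where l: "\<And>p. degree p < card T \<Longrightarrow> poly p t = (\<Sum>w\<in>T. l w * poly p w)"
    using Lagrange_interpolation[OF T(1)] by metis
  show thesis
  proof
    show "\<forall>w\<in>T. r \<le> w" by (auto simp: T_def)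
    fix f :: "(real ^ 'b) \<times> real \<Rightarrow> real" and x assume "f \<in> poly_deg_le n"
    then obtain q where "degree q \<le> n" "\<And>t. f (x, t) = poly q t"
      using poly_deg_le_section by blast
    then show "f (x, t) = (\<Sum>w\<in>T. l w * f (x, w))"
      using l T(2) by simp
  qed
qed

subsection \<open>The weight after the substitution\<close>

text \<open>The halves t > 0 and t < 0 contribute equally, and the resulting factor 2 turns
  \<open>\<bar>t\<bar>\<close> into the derivative 2 t of
  \<open>t\<^sup>2 - \<rho>\<^sup>2\<close>.\<close>

lemma nn_integral_shifted_square:
  fixes k :: "real \<Rightarrow> real"
  assumes k [measurable]: "k \<in> borel_measurable borel" and \<rho>: "\<rho> \<ge> 0"
  shows "(\<integral>\<^sup>+t. ennreal (\<bar>t\<bar> * k (t\<^sup>2 - \<rho>\<^sup>2)) * indicator {t. \<rho> \<le> \<bar>t\<bar> \<and> \<bar>t\<bar> \<le> sqrt (\<rho>\<^sup>2 + 1)} t \<partial>lborel)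
    = (\<integral>\<^sup>+u. ennreal (k u) * indicator {0..1} u \<partial>lborel)"
proof -
  define R where "R = sqrt (\<rho>\<^sup>2 + 1)"
  have R: "\<rho> \<le> R" "R\<^sup>2 - \<rho>\<^sup>2 = 1"
    unfolding R_def by (auto intro!: real_le_rsqrt)
  define F where "F t = ennreal (\<bar>t\<bar> * k (t\<^sup>2 - \<rho>\<^sup>2)) * indicator {\<rho>..R} t" for t
  have [measurable]: "F \<in> borel_measurable borel"
    unfolding F_def by measurable
  have "(\<integral>\<^sup>+t. ennreal (\<bar>t\<bar> * k (t\<^sup>2 - \<rho>\<^sup>2)) * indicator {t. \<rho> \<le> \<bar>t\<bar> \<and> \<bar>t\<bar> \<le> R} t \<partial>lborel)
      = (\<integral>\<^sup>+t. F t + F (- t) \<partial>lborel)"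
  proof (intro nn_integral_cong)
    fix t
    \<comment> \<open>For \<open>\<rho> = 0\<close> the two halves share the point
      \<open>t = 0\<close>, where the factor \<open>\<bar>t\<bar>\<close> vanishes.\<close>
    show "ennreal (\<bar>t\<bar> * k (t\<^sup>2 - \<rho>\<^sup>2)) * indicator {t. \<rho> \<le> \<bar>t\<bar> \<and> \<bar>t\<bar> \<le> R} t = F t + F (- t)"
      using \<rho> by (cases "t = 0") (auto simp: F_def indicator_def abs_if)
  qed
  also have "\<dots> = (\<integral>\<^sup>+t. F t \<partial>lborel) + (\<integral>\<^sup>+t. F (- t) \<partial>lborel)"
    by (intro nn_integral_add) auto
  also have "(\<integral>\<^sup>+t. F (- t) \<partial>lborel) = (\<integral>\<^sup>+t. F t \<partial>lborel)"
    using nn_integral_real_affine[of F "- 1" 0] by simp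
  also have "(\<integral>\<^sup>+t. F t \<partial>lborel) + (\<integral>\<^sup>+t. F t \<partial>lborel) = (\<integral>\<^sup>+t. F t + F t \<partial>lborel)"
    by (intro nn_integral_add[symmetric]) auto
  also have "\<dots> = (\<integral>\<^sup>+t. ennreal (k (t\<^sup>2 - \<rho>\<^sup>2) * (2 * t) * indicator {\<rho>..R} t) \<partial>lborel)"
  proof (intro nn_integral_cong)
    fix t
    show "F t + F t = ennreal (k (t\<^sup>2 - \<rho>\<^sup>2) * (2 * t) * indicator {\<rho>..R} t)"
    \<comment> \<open>\<open>ennreal\<close> sends negative reals to 0, so each sign of
      \<open>k\<close> is treated separately.\<close>
    proof (cases "k (t\<^sup>2 - \<rho>\<^sup>2) \<ge> 0")
      case True
      then show ?thesis
        using \<rho> by (auto simp: F_def indicator_def ennreal_plus[symmetric] simp del: ennreal_plus)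
    next
      case False
      then show ?thesis
        using \<rho> by (auto simp: F_def indicator_def ennreal_neg mult_nonneg_nonpos mult_nonpos_nonneg)
    qed
  qed
  also have "\<dots> = (\<integral>\<^sup>+u. ennreal (k u * indicator {\<rho>\<^sup>2 - \<rho>\<^sup>2..R\<^sup>2 - \<rho>\<^sup>2} u) \<partial>lborel)"
    using R(1) \<rho>
    by (intro nn_integral_substitution[symmetric])
       (auto intro!: derivative_eq_intros continuous_intros simp: set_borel_measurable_def)
  also have "\<dots> = (\<integral>\<^sup>+u. ennreal (k u) * indicator {0..1} u \<partial>lborel)"
    by (intro nn_integral_cong) (auto simp: R indicator_def)
  finally show ?thesis
    by (simp add: R_def)
qed

lemma closed_solid_hyperboloid: "closed (solid_hyperboloid \<rho> :: ((real ^ 'd) \<times> real) set)"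
  unfolding solid_hyperboloid_def case_prod_unfold
  by (intro closed_Collect_conj closed_Collect_le continuous_intros)

lemma borel_measurable_weight [measurable]: "weight \<rho> \<beta> \<gamma> \<mu> \<in> borel_measurable borel"
  unfolding weight_def case_prod_unfold borel_prod[symmetric] by measurable

lemma sets_solid_hyperboloid [measurable]: "solid_hyperboloid \<rho> \<in> sets borel"
  by (intro borel_closed closed_solid_hyperboloid)

lemma weight_nonneg: "weight \<rho> \<beta> \<gamma> \<mu> p \<ge> 0"
  by (auto simp: weight_def split: prod.split)

section \<open>The weight as a measure and its image in the variables (x, u)\<close>

definition weight_measure :: "real \<Rightarrow> real \<Rightarrow> real \<Rightarrow> real \<Rightarrow> ((real ^ 'd) \<times> real) measure" where
  "weight_measure \<rho> \<beta> \<gamma> \<mu> =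
     density lborel (\<lambda>p. indicator (solid_hyperboloid \<rho>) p * weight \<rho> \<beta> \<gamma> \<mu> p)"

lemma sets_weight_measure [measurable_cong, simp]: "sets (weight_measure \<rho> \<beta> \<gamma> \<mu>) = sets borel"
  by (simp add: weight_measure_def)

lemma space_weight_measure [simp]: "space (weight_measure \<rho> \<beta> \<gamma> \<mu>) = UNIV"
  by (simp add: weight_measure_def)

lemma AE_weight_measure: "AE p in weight_measure \<rho> \<beta> \<gamma> \<mu>. p \<in> solid_hyperboloid \<rho>"
  unfolding weight_measure_def by (subst AE_density) (auto simp: indicator_def)

text \<open>The constant b is the reciprocal of the total mass. If the mass is infinite,
  \<open>measure\<close> and the Bochner integral of the weight are both 0 by convention, so the
  identity persists.\<close>

lemma inner_W_eq_integral:
  fixes f g :: "(real ^ 'd) \<times> real \<Rightarrow> real"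
  assumes [measurable]: "f \<in> borel_measurable borel" "g \<in> borel_measurable borel"
  shows "inner_W \<rho> \<beta> \<gamma> \<mu> f g =
    1 / measure (weight_measure \<rho> \<beta> \<gamma> \<mu> :: ((real ^ 'd) \<times> real) measure) UNIV * (\<integral>p. f p * g p \<partial>weight_measure \<rho> \<beta> \<gamma> \<mu>)"
proof -
  have integral: "(\<integral>p. h p \<partial>weight_measure \<rho> \<beta> \<gamma> \<mu>)
      = (LINT p:solid_hyperboloid \<rho>|lborel. h p * weight \<rho> \<beta> \<gamma> \<mu> p)"
    if [measurable]: "h \<in> borel_measurable borel" for h :: "(real ^ 'd) \<times> real \<Rightarrow> real"
    unfolding weight_measure_def set_lebesgue_integral_def
    by (subst integral_density) (auto simp: weight_nonneg mult_ac)
  show ?thesis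
    using integral[of "\<lambda>_. 1"] integral[of "\<lambda>p. f p * g p"] by (simp add: inner_W_def)
qed

text \<open>The weight in terms of \<open>u = t\<^sup>2 - \<rho>\<^sup>2\<close>:
  \<open>\<rho>\<^sup>2 + 1 - t\<^sup>2\<close> becomes \<open>1 - u\<close>, the factor
  \<open>\<bar>t\<bar>\<close> is absorbed by du, and \<open>\<rho>\<close> has disappeared.\<close>

definition profile_measure :: "real \<Rightarrow> real \<Rightarrow> real \<Rightarrow> ((real ^ 'd) \<times> real) measure" where
  "profile_measure \<beta> \<gamma> \<mu> = density lborel (\<lambda>(x, u).
     of_bool ((norm x)\<^sup>2 \<le> u) * u powr (\<beta> - 1/2) * (1 - u) powr (\<gamma> - 1/2)
       * (u - (norm x)\<^sup>2) powr (\<mu> - 1/2) * indicator {0..1} u)"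

text \<open>By Tonelli, the claim reduces to the one-dimensional substitution at each fixed
  \<open>x\<close>.\<close>

lemma distr_weight_measure:
  assumes "\<rho> \<ge> 0"
  shows "distr (weight_measure \<rho> \<beta> \<gamma> \<mu> :: ((real ^ 'd) \<times> real) measure) borel (\<lambda>(x, t). (x, t\<^sup>2 - \<rho>\<^sup>2))
    = profile_measure \<beta> \<gamma> \<mu>"
proof (rule measure_eqI)
  define k where "k x u = of_bool ((norm x)\<^sup>2 \<le> u) * u powr (\<beta> - 1/2) * (1 - u) powr (\<gamma> - 1/2)
       * (u - (norm x)\<^sup>2) powr (\<mu> - 1/2)" for x :: "real ^ 'd" and u :: real
  have [measurable]: "(\<lambda>(x, u). k x u) \<in> borel_measurable (borel \<Otimes>\<^sub>M borel)"
    unfolding k_def of_bool_def by measurable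
  fix A assume "A \<in> sets (distr (weight_measure \<rho> \<beta> \<gamma> \<mu> :: ((real ^ 'd) \<times> real) measure) borel (\<lambda>(x, t). (x, t\<^sup>2 - \<rho>\<^sup>2)))"
  then have A' [measurable]: "A \<in> sets borel"
    by simp
  then have A [measurable]: "A \<in> sets (borel \<Otimes>\<^sub>M borel)"
    unfolding borel_prod by simp
  have [measurable]: "(\<lambda>p :: (real ^ 'd) \<times> real. (fst p, (snd p)\<^sup>2 - \<rho>\<^sup>2)) \<in> borel \<rightarrow>\<^sub>M borel"
    by (intro borel_measurable_continuous_onI continuous_intros)
  have [measurable]: "weight \<rho> \<beta> \<gamma> \<mu> \<in> borel_measurable ((borel :: (real ^ 'd) measure) \<Otimes>\<^sub>M borel)"
    "(solid_hyperboloid \<rho> :: ((real ^ 'd) \<times> real) set) \<in> sets (borel \<Otimes>\<^sub>M borel)"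
    unfolding borel_prod by simp_all
  have "emeasure (distr (weight_measure \<rho> \<beta> \<gamma> \<mu>) borel (\<lambda>(x, t). (x, t\<^sup>2 - \<rho>\<^sup>2))) A
      = (\<integral>\<^sup>+p. ennreal (indicator (solid_hyperboloid \<rho>) p * weight \<rho> \<beta> \<gamma> \<mu> p)
           * indicator A (fst p, (snd p)\<^sup>2 - \<rho>\<^sup>2) \<partial>(lborel \<Otimes>\<^sub>M lborel))"
    unfolding weight_measure_def lborel_prod case_prod_unfold
    by (subst nn_integral_indicator[symmetric], simp, subst nn_integral_distr, simp_all add: nn_integral_density)
  also have "\<dots> = (\<integral>\<^sup>+x. \<integral>\<^sup>+t. ennreal (indicator (solid_hyperboloid \<rho>) (x, t) * weight \<rho> \<beta> \<gamma> \<mu> (x, t))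
           * indicator A (x, t\<^sup>2 - \<rho>\<^sup>2) \<partial>lborel \<partial>lborel)"
    by (subst lborel.nn_integral_fst[symmetric]) auto
  also have "\<dots> = (\<integral>\<^sup>+x. \<integral>\<^sup>+u. ennreal (k x u * indicator {0..1} u) * indicator A (x, u) \<partial>lborel \<partial>lborel)"
  proof (rule nn_integral_cong)
    fix x :: "real ^ 'd"
    \<comment> \<open>The indicator of \<open>A\<close> depends on \<open>t\<close> only through
      \<open>t\<^sup>2 - \<rho>\<^sup>2\<close>, so it can join \<open>k x\<close> in the integrand
      to be substituted.\<close>
    have "(\<integral>\<^sup>+t. ennreal (indicator (solid_hyperboloid \<rho>) (x, t) * weight \<rho> \<beta> \<gamma> \<mu> (x, t))
           * indicator A (x, t\<^sup>2 - \<rho>\<^sup>2) \<partial>lborel)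
        = (\<integral>\<^sup>+t. ennreal (\<bar>t\<bar> * (k x (t\<^sup>2 - \<rho>\<^sup>2) * indicator A (x, t\<^sup>2 - \<rho>\<^sup>2)))
            * indicator {t. \<rho> \<le> \<bar>t\<bar> \<and> \<bar>t\<bar> \<le> sqrt (\<rho>\<^sup>2 + 1)} t \<partial>lborel)"
      by (intro nn_integral_cong)
         (auto simp: k_def weight_def solid_hyperboloid_def indicator_def algebra_simps)
    also have "\<dots> = (\<integral>\<^sup>+u. ennreal (k x u * indicator A (x, u)) * indicator {0..1} u \<partial>lborel)"
      using assms by (intro nn_integral_shifted_square) measurable
    also have "\<dots> = (\<integral>\<^sup>+u. ennreal (k x u * indicator {0..1} u) * indicator A (x, u) \<partial>lborel)"
      by (intro nn_integral_cong) (auto simp: indicator_def)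
    finally show "(\<integral>\<^sup>+t. ennreal (indicator (solid_hyperboloid \<rho>) (x, t) * weight \<rho> \<beta> \<gamma> \<mu> (x, t))
           * indicator A (x, t\<^sup>2 - \<rho>\<^sup>2) \<partial>lborel)
        = (\<integral>\<^sup>+u. ennreal (k x u * indicator {0..1} u) * indicator A (x, u) \<partial>lborel)" .
  qed
  also have "\<dots> = (\<integral>\<^sup>+p. ennreal (k (fst p) (snd p) * indicator {0..1} (snd p)) * indicator A p \<partial>(lborel \<Otimes>\<^sub>M lborel))"
    by (subst lborel.nn_integral_fst[symmetric]) auto
  also have "\<dots> = emeasure (profile_measure \<beta> \<gamma> \<mu>) A"
    unfolding profile_measure_def lborel_prod k_def[symmetric]
    by (subst emeasure_density) (auto simp: borel_prod[symmetric] case_prod_unfold)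
  finally show "emeasure (distr (weight_measure \<rho> \<beta> \<gamma> \<mu>) borel (\<lambda>(x, t). (x, t\<^sup>2 - \<rho>\<^sup>2))) A
      = emeasure (profile_measure \<beta> \<gamma> \<mu>) A" .
qed (simp add: profile_measure_def)

lemma integral_weight_measure:
  fixes h F :: "(real ^ 'd) \<times> real \<Rightarrow> real"
  assumes [measurable]: "h \<in> borel_measurable borel" "F \<in> borel_measurable borel" and "\<rho> \<ge> 0"
    and h: "\<And>x t. (x, t) \<in> solid_hyperboloid \<rho> \<Longrightarrow> h (x, t) = F (x, t\<^sup>2 - \<rho>\<^sup>2)"
  shows "(\<integral>p. h p \<partial>weight_measure \<rho> \<beta> \<gamma> \<mu>) = (\<integral>p. F p \<partial>profile_measure \<beta> \<gamma> \<mu>)"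
proof -
  have [measurable]: "(\<lambda>(x, t). (x, t\<^sup>2 - \<rho>\<^sup>2)) \<in> (borel :: ((real ^ 'd) \<times> real) measure) \<rightarrow>\<^sub>M borel"
    unfolding case_prod_unfold by (intro borel_measurable_continuous_onI continuous_intros)
  have "(\<integral>p. h p \<partial>weight_measure \<rho> \<beta> \<gamma> \<mu>)
      = (\<integral>p. F (case p of (x, t) \<Rightarrow> (x, t\<^sup>2 - \<rho>\<^sup>2)) \<partial>weight_measure \<rho> \<beta> \<gamma> \<mu>)"
    by (intro integral_cong_AE eventually_mono[OF AE_weight_measure]) (auto simp: h)
  also have "\<dots> = (\<integral>p. F p \<partial>profile_measure \<beta> \<gamma> \<mu>)"
    unfolding distr_weight_measure[OF \<open>\<rho> \<ge> 0\<close>, symmetric] by (subst integral_distr) auto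
  finally show ?thesis .
qed

lemma solid_hyperboloid_nonneg:
  assumes "(x, t) \<in> solid_hyperboloid \<rho>"
  shows "0 \<le> t\<^sup>2 - \<rho>\<^sup>2"
proof -
  have "0 \<le> (norm x)\<^sup>2" by simp
  also have "\<dots> \<le> t\<^sup>2 - \<rho>\<^sup>2"
    using assms by (simp add: solid_hyperboloid_def)
  finally show ?thesis .
qed

text \<open>Both forms integrate one product profile against the same
  \<open>profile_measure\<close>, with equal normalizing constants.\<close>

lemma inner_W_same_profile:
  fixes f g f' g' :: "(real ^ 'd) \<times> real \<Rightarrow> real"
  assumes "\<rho> \<ge> 0" "\<sigma> \<ge> 0" and cont: "continuous_on UNIV f" "continuous_on UNIV g"
      "continuous_on UNIV f'" "continuous_on UNIV g'"
    and even: "even_in_t f" "even_in_t g"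
    and same: "same_profile \<rho> \<sigma> f f'" "same_profile \<rho> \<sigma> g g'"
  shows "inner_W \<rho> \<beta> \<gamma> \<mu> f g = inner_W \<sigma> \<beta> \<gamma> \<mu> f' g'"
proof -
  \<comment> \<open>The profile of the product, read off at the nonnegative root of
    \<open>t\<^sup>2 - \<rho>\<^sup>2 = u\<close> when \<open>u \<ge> - \<rho>\<^sup>2\<close>. The
    real \<open>sqrt\<close> is continuous also at negative arguments, so \<open>F\<close> is
    continuous everywhere.\<close>
  define F where "F = (\<lambda>(x, u). f (x, sqrt (u + \<rho>\<^sup>2)) * g (x, sqrt (u + \<rho>\<^sup>2)))"
  have [measurable]: "f \<in> borel_measurable borel" "g \<in> borel_measurable borel"
    "f' \<in> borel_measurable borel" "g' \<in> borel_measurable borel"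
    using cont by (auto intro: borel_measurable_continuous_onI)
  have [measurable]: "F \<in> borel_measurable borel"
    unfolding F_def case_prod_unfold
    by (intro borel_measurable_continuous_onI continuous_intros
        continuous_on_compose2[OF cont(1)] continuous_on_compose2[OF cont(2)]) auto
  have "(\<integral>p. f p * g p \<partial>weight_measure \<rho> \<beta> \<gamma> \<mu>) = (\<integral>p. F p \<partial>profile_measure \<beta> \<gamma> \<mu>)"
  proof (rule integral_weight_measure)
    show "f (x, t) * g (x, t) = F (x, t\<^sup>2 - \<rho>\<^sup>2)" for x t
      using even by (simp add: F_def even_in_t_abs)
  qed (use \<open>\<rho> \<ge> 0\<close> in auto)
  moreover have "(\<integral>p. f' p * g' p \<partial>weight_measure \<sigma> \<beta> \<gamma> \<mu>) = (\<integral>p. F p \<partial>profile_measure \<beta> \<gamma> \<mu>)"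
  proof (rule integral_weight_measure)
    fix x :: "real ^ 'd" and s assume "(x, s) \<in> solid_hyperboloid \<sigma>"
    then have "0 \<le> s\<^sup>2 - \<sigma>\<^sup>2"
      by (rule solid_hyperboloid_nonneg)
    then have "(sqrt (s\<^sup>2 - \<sigma>\<^sup>2 + \<rho>\<^sup>2))\<^sup>2 - \<rho>\<^sup>2 = s\<^sup>2 - \<sigma>\<^sup>2" by simp
    then show "f' (x, s) * g' (x, s) = F (x, s\<^sup>2 - \<sigma>\<^sup>2)"
      using same by (simp add: F_def same_profile_def)
  qed (use \<open>\<sigma> \<ge> 0\<close> in auto)
  \<comment> \<open>The constant integrand 1 compares the total masses.\<close>
  moreover have "measure (weight_measure \<rho> \<beta> \<gamma> \<mu> :: ((real ^ 'd) \<times> real) measure) UNIV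
      = measure (weight_measure \<sigma> \<beta> \<gamma> \<mu> :: ((real ^ 'd) \<times> real) measure) UNIV"
    using integral_weight_measure[of "\<lambda>_ :: (real ^ 'd) \<times> real. 1" "\<lambda>_. 1" \<rho> \<beta> \<gamma> \<mu>]
      integral_weight_measure[of "\<lambda>_ :: (real ^ 'd) \<times> real. 1" "\<lambda>_. 1" \<sigma> \<beta> \<gamma> \<mu>] assms(1,2) by simp
  ultimately show ?thesis
    by (simp add: inner_W_eq_integral)
qed

section \<open>Integrability, linearity and reflection invariance of the form\<close>

lemma bounded_solid_hyperboloid: "bounded (solid_hyperboloid \<rho> :: ((real ^ 'd) \<times> real) set)"
proof (rule bounded_subset)
  show "(solid_hyperboloid \<rho> :: ((real ^ 'd) \<times> real) set) \<subseteq> cball 0 1 \<times> {- sqrt (\<rho>\<^sup>2 + 1)..sqrt (\<rho>\<^sup>2 + 1)}"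
  proof clarify
    fix x :: "real ^ 'd" and t assume *: "(x, t) \<in> solid_hyperboloid \<rho>"
    then have "\<bar>t\<bar> \<le> sqrt (\<rho>\<^sup>2 + 1)" by (simp add: solid_hyperboloid_def)
    then have "t\<^sup>2 \<le> \<rho>\<^sup>2 + 1"
      by (metis abs_ge_zero power2_abs power_mono real_sqrt_pow2 add_nonneg_nonneg zero_le_power2 zero_le_one)
    with * have "(norm x)\<^sup>2 \<le> 1\<^sup>2" by (simp add: solid_hyperboloid_def)
    then have "norm x \<le> 1" by (rule power2_le_imp_le) simp
    with * show "x \<in> cball 0 1 \<and> t \<in> {- sqrt (\<rho>\<^sup>2 + 1)..sqrt (\<rho>\<^sup>2 + 1)}"
      by (auto simp: solid_hyperboloid_def)
  qed
qed (simp add: bounded_Times)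

text \<open>A continuous function is bounded on the compact hyperboloid, which carries the
  measure.\<close>

lemma integrable_weight_measure:
  fixes h :: "(real ^ 'd) \<times> real \<Rightarrow> real"
  assumes "finite_measure (weight_measure \<rho> \<beta> \<gamma> \<mu> :: ((real ^ 'd) \<times> real) measure)" "continuous_on UNIV h"
  shows "integrable (weight_measure \<rho> \<beta> \<gamma> \<mu>) h"
proof -
  interpret finite_measure "weight_measure \<rho> \<beta> \<gamma> \<mu> :: ((real ^ 'd) \<times> real) measure" by fact
  have "compact (solid_hyperboloid \<rho> :: ((real ^ 'd) \<times> real) set)"
    by (simp add: compact_eq_bounded_closed bounded_solid_hyperboloid closed_solid_hyperboloid)
  then have "bounded (h ` solid_hyperboloid \<rho>)"
    using assms(2) by (intro compact_imp_bounded compact_continuous_image) (auto intro: continuous_on_subset)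
  then obtain B where "\<forall>p\<in>solid_hyperboloid \<rho>. norm (h p) \<le> B"
    by (auto simp: bounded_iff)
  moreover have [measurable]: "h \<in> borel_measurable borel"
    using assms(2) by (rule borel_measurable_continuous_onI)
  ultimately show ?thesis
    by (intro integrable_const_bound[of _ B] eventually_mono[OF AE_weight_measure]) auto
qed

lemma inner_W_commute: "inner_W \<rho> \<beta> \<gamma> \<mu> f g = inner_W \<rho> \<beta> \<gamma> \<mu> g f"
  by (simp add: inner_W_def mult.commute)

text \<open>
  For a non-integrable weight the normalizing constant is \<open>1 / 0 = 0\<close>, so the form
  is linear in this case, too.
\<close>

lemma inner_W_sum_left:
  fixes f :: "'i \<Rightarrow> (real ^ 'd) \<times> real \<Rightarrow> real"
  assumes f: "\<And>i. i \<in> I \<Longrightarrow> continuous_on UNIV (f i)" and g: "continuous_on UNIV g"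
  shows "inner_W \<rho> \<beta> \<gamma> \<mu> (\<lambda>p. \<Sum>i\<in>I. c i * f i p) g = (\<Sum>i\<in>I. c i * inner_W \<rho> \<beta> \<gamma> \<mu> (f i) g)"
proof -
  let ?M = "weight_measure \<rho> \<beta> \<gamma> \<mu> :: ((real ^ 'd) \<times> real) measure"
  have [measurable]: "\<And>i. i \<in> I \<Longrightarrow> f i \<in> borel_measurable borel" "g \<in> borel_measurable borel"
    using f g by (auto intro: borel_measurable_continuous_onI)
  show ?thesis
  proof (cases "measure ?M UNIV = 0")
    case True
    then show ?thesis by (simp add: inner_W_eq_integral)
  next
    case False
    \<comment> \<open>An infinite total mass would have given \<open>measure\<close> the value
      0.\<close>
    then have "finite_measure ?M"
      by (intro finite_measureI) (auto simp: measure_def)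
    then have int: "integrable ?M (\<lambda>p. f i p * g p)" if "i \<in> I" for i
      using f g that by (intro integrable_weight_measure continuous_intros) auto
    have "(\<integral>p. (\<Sum>i\<in>I. c i * f i p) * g p \<partial>?M) = (\<integral>p. (\<Sum>i\<in>I. c i * (f i p * g p)) \<partial>?M)"
      by (simp add: sum_distrib_right mult.assoc)
    also have "\<dots> = (\<Sum>i\<in>I. c i * (\<integral>p. f i p * g p \<partial>?M))"
      using int by (subst Bochner_Integration.integral_sum) auto
    finally show ?thesis
      by (simp add: inner_W_eq_integral sum_distrib_left mult_ac)
  qed
qed

lemma distr_lborel_reflect:
  "distr lborel borel (\<lambda>(x, t). (x, - t)) = (lborel :: ((real ^ 'd) \<times> real) measure)"
proof (rule measure_eqI)
  have [measurable]: "(\<lambda>p. (fst p, - snd p)) \<in> (borel :: ((real ^ 'd) \<times> real) measure) \<rightarrow>\<^sub>M borel"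
    by (intro borel_measurable_continuous_onI continuous_intros)
  fix A :: "((real ^ 'd) \<times> real) set" assume "A \<in> sets (distr lborel borel (\<lambda>(x, t). (x, - t)))"
  then have [measurable]: "A \<in> sets borel" by simp
  then have [measurable]: "A \<in> sets (borel \<Otimes>\<^sub>M borel)"
    unfolding borel_prod by simp
  have "emeasure (distr lborel borel (\<lambda>(x, t). (x, - t))) A
      = (\<integral>\<^sup>+p. indicator A (fst p, - snd p) \<partial>(lborel \<Otimes>\<^sub>M lborel))"
    unfolding lborel_prod case_prod_unfold
    by (subst nn_integral_indicator[symmetric], simp, subst nn_integral_distr) simp_all
  also have "\<dots> = (\<integral>\<^sup>+x. \<integral>\<^sup>+t. indicator A (x, - t) \<partial>lborel \<partial>lborel)"
    by (subst lborel.nn_integral_fst[symmetric]) auto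
  also have "\<dots> = (\<integral>\<^sup>+x. \<integral>\<^sup>+t. indicator A (x, t) \<partial>lborel \<partial>lborel)"
  proof (rule nn_integral_cong)
    show "(\<integral>\<^sup>+t. indicator A (x, - t) \<partial>lborel) = (\<integral>\<^sup>+t. indicator A (x, t) \<partial>lborel)" for x
      using nn_integral_real_affine[of "\<lambda>t. indicator A (x, t)" "- 1" 0] by simp
  qed
  also have "\<dots> = emeasure lborel A"
    by (subst lborel.nn_integral_fst) (auto simp: lborel_prod)
  finally show "emeasure (distr lborel borel (\<lambda>(x, t). (x, - t))) A = emeasure lborel A" .
qed simp

text \<open>The domain, the weight and \<open>f\<close> are all invariant under the reflection in
  \<open>t\<close>, and so is Lebesgue measure.\<close>

lemma inner_W_reflect:
  fixes f g :: "(real ^ 'd) \<times> real \<Rightarrow> real"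
  assumes [measurable]: "f \<in> borel_measurable borel" "g \<in> borel_measurable borel" and even: "even_in_t f"
  shows "inner_W \<rho> \<beta> \<gamma> \<mu> f (\<lambda>(x, t). g (x, - t)) = inner_W \<rho> \<beta> \<gamma> \<mu> f g"
proof -
  let ?h = "\<lambda>p :: (real ^ 'd) \<times> real. indicator (solid_hyperboloid \<rho>) p *\<^sub>R (f p * g p * weight \<rho> \<beta> \<gamma> \<mu> p)"
  have [measurable]: "(\<lambda>(x, t). (x, - t)) \<in> (borel :: ((real ^ 'd) \<times> real) measure) \<rightarrow>\<^sub>M borel"
    unfolding case_prod_unfold by (intro borel_measurable_continuous_onI continuous_intros)
  have "(\<integral>p. ?h p \<partial>lborel) = (\<integral>p. ?h p \<partial>distr lborel borel (\<lambda>(x, t). (x, - t)))"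
    by (simp only: distr_lborel_reflect)
  also have "\<dots> = (\<integral>p. ?h (case p of (x, t) \<Rightarrow> (x, - t)) \<partial>lborel)"
    by (rule integral_distr) auto
  also have "\<dots> = (\<integral>p. indicator (solid_hyperboloid \<rho>) p *\<^sub>R
      (f p * (case p of (x, t) \<Rightarrow> g (x, - t)) * weight \<rho> \<beta> \<gamma> \<mu> p) \<partial>lborel)"
    using even
    by (intro Bochner_Integration.integral_cong)
       (auto simp: even_in_t_def weight_def solid_hyperboloid_def indicator_def)
  finally show ?thesis
    by (simp add: inner_W_def set_lebesgue_integral_def)
qed

subsection \<open>Transfer of reproducing kernels\<close>

text \<open>Only even test polynomials have profiles to transfer. They suffice: \<open>g\<close>
  plus its reflection is even, and both summands have the same inner product with the even
  \<open>f\<close>.\<close>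

lemma V_even_iff:
  "f \<in> V_even n \<rho> \<beta> \<gamma> \<mu> \<longleftrightarrow> f \<in> poly_deg_le n \<and> even_in_t f \<and>
     (\<forall>m<n. \<forall>g\<in>poly_deg_le m. even_in_t g \<longrightarrow> inner_W \<rho> \<beta> \<gamma> \<mu> f g = 0)"
proof -
  have "inner_W \<rho> \<beta> \<gamma> \<mu> f g = 0"
    if f: "f \<in> poly_deg_le n" "even_in_t f" and g: "g \<in> poly_deg_le m"
      and orth: "\<And>g. g \<in> poly_deg_le m \<Longrightarrow> even_in_t g \<Longrightarrow> inner_W \<rho> \<beta> \<gamma> \<mu> f g = 0" for g m
  proof -
    \<comment> \<open>Indexing \<open>g\<close> and its reflection by \<open>bool\<close> makes
      their sum an instance of \<open>inner_W_sum_left\<close>.\<close>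
    let ?g = "\<lambda>b :: bool. if b then g else (\<lambda>(x, t). g (x, - t))"
    have g': "?g b \<in> poly_deg_le m" for b
      using g by (simp add: poly_deg_le_reflect)
    have "inner_W \<rho> \<beta> \<gamma> \<mu> (\<lambda>p. \<Sum>b\<in>UNIV. 1 * ?g b p) f = (\<Sum>b\<in>UNIV. 1 * inner_W \<rho> \<beta> \<gamma> \<mu> (?g b) f)"
      by (intro inner_W_sum_left continuous_on_poly_deg_le[OF g'] continuous_on_poly_deg_le[OF f(1)])
    moreover have "inner_W \<rho> \<beta> \<gamma> \<mu> (\<lambda>p. \<Sum>b\<in>UNIV. 1 * ?g b p) f = 0"
    proof (subst inner_W_commute, rule orth)
      show "(\<lambda>p. \<Sum>b\<in>UNIV. 1 * ?g b p) \<in> poly_deg_le m"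
        by (intro poly_deg_le_sum poly_deg_le_cmult g')
    qed (auto simp: even_in_t_def UNIV_bool)
    ultimately have "inner_W \<rho> \<beta> \<gamma> \<mu> f g + inner_W \<rho> \<beta> \<gamma> \<mu> f (\<lambda>(x, t). g (x, - t)) = 0"
      by (simp add: UNIV_bool inner_W_commute[of _ _ _ _ f] add.commute)
    then show ?thesis
      using inner_W_reflect[of f g] f g borel_measurable_poly_deg_le by fastforce
  qed
  then show ?thesis
    unfolding V_even_def even_in_t_def[symmetric] by blast
qed

lemma V_even_sum:
  fixes f :: "'i \<Rightarrow> (real ^ 'd) \<times> real \<Rightarrow> real"
  assumes "\<And>i. i \<in> I \<Longrightarrow> f i \<in> V_even n \<rho> \<beta> \<gamma> \<mu>"
  shows "(\<lambda>p. \<Sum>i\<in>I. c i * f i p) \<in> V_even n \<rho> \<beta> \<gamma> \<mu>"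
proof -
  have f: "f i \<in> poly_deg_le n" "even_in_t (f i)"
    "\<And>m g. m < n \<Longrightarrow> g \<in> poly_deg_le m \<Longrightarrow> even_in_t g \<Longrightarrow> inner_W \<rho> \<beta> \<gamma> \<mu> (f i) g = 0" if "i \<in> I" for i
    using assms[OF that] by (auto simp: V_even_iff)
  show ?thesis
    unfolding V_even_iff
  proof (intro conjI allI impI ballI)
    show "(\<lambda>p. \<Sum>i\<in>I. c i * f i p) \<in> poly_deg_le n"
      using f by (intro poly_deg_le_sum poly_deg_le_cmult) auto
    show "even_in_t (\<lambda>p. \<Sum>i\<in>I. c i * f i p)"
      using f(2) by (simp add: even_in_t_def)
    show "inner_W \<rho> \<beta> \<gamma> \<mu> (\<lambda>p. \<Sum>i\<in>I. c i * f i p) g = 0"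
      if "m < n" "g \<in> poly_deg_le m" "even_in_t g" for m g
      using f(3) that continuous_on_poly_deg_le[OF f(1)] continuous_on_poly_deg_le by (subst inner_W_sum_left) (auto intro!: sum.neutral)
  qed
qed

text \<open>A test polynomial for \<open>\<sigma>\<close> is moved back to \<open>\<rho>\<close>,
  where \<open>f\<close> is orthogonal to it.\<close>

lemma V_even_same_profile:
  assumes nonneg: "\<rho> \<ge> 0" "\<sigma> \<ge> 0" and f: "f \<in> V_even n \<rho> \<beta> \<gamma> \<mu>"
  obtains g where "g \<in> V_even n \<sigma> \<beta> \<gamma> \<mu>" "same_profile \<rho> \<sigma> f g"
proof -
  obtain g where g: "g \<in> poly_deg_le n" "even_in_t g" "same_profile \<rho> \<sigma> f g"
    using f ex_same_profile by (metis V_even_iff)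
  have "inner_W \<sigma> \<beta> \<gamma> \<mu> g h = 0" if h: "m < n" "h \<in> poly_deg_le m" "even_in_t h" for m h
  proof -
    obtain h' where h': "h' \<in> poly_deg_le m" "even_in_t h'" "same_profile \<sigma> \<rho> h h'"
      using h ex_same_profile by metis
    have "inner_W \<rho> \<beta> \<gamma> \<mu> f h' = inner_W \<sigma> \<beta> \<gamma> \<mu> g h"
      using nonneg f g h h'
      by (intro inner_W_same_profile) (auto simp: V_even_iff same_profile_sym[of \<rho>] intro: continuous_on_poly_deg_le)
    then show ?thesis
      using f h h' by (auto simp: V_even_iff)
  qed
  then have "g \<in> V_even n \<sigma> \<beta> \<gamma> \<mu>"
    using g by (auto simp: V_even_iff)
  with g that show thesis by blast
qed

text \<open>The condition on a single section \<open>K p\<close> of a reproducing kernel, so that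
  sections can be transferred one at a time.\<close>

definition represents_eval ::
    "(('a \<Rightarrow> real) \<Rightarrow> ('a \<Rightarrow> real) \<Rightarrow> real) \<Rightarrow> ('a \<Rightarrow> real) set \<Rightarrow> 'a \<Rightarrow> ('a \<Rightarrow> real) \<Rightarrow> bool" where
  "represents_eval ip V p k \<longleftrightarrow> k \<in> V \<and> (\<forall>f\<in>V. ip f k = f p)"

text \<open>A kernel is an independent choice of a representer at each point, so its section at
  \<open>p\<close> may be replaced by any given representer there.\<close>

lemma ex_reproducing_kernel_value_iff:
  "(\<exists>K. is_reproducing_kernel ip V K \<and> r = K p q) \<longleftrightarrow>
     (\<forall>p. \<exists>k. represents_eval ip V p k) \<and> (\<exists>k. represents_eval ip V p k \<and> r = k q)"
proof
  assume "\<exists>K. is_reproducing_kernel ip V K \<and> r = K p q"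
  then show "(\<forall>p. \<exists>k. represents_eval ip V p k) \<and> (\<exists>k. represents_eval ip V p k \<and> r = k q)"
    unfolding is_reproducing_kernel_def represents_eval_def by blast
next
  assume "(\<forall>p. \<exists>k. represents_eval ip V p k) \<and> (\<exists>k. represents_eval ip V p k \<and> r = k q)"
  then obtain K k where "\<And>p. represents_eval ip V p (K p)" "represents_eval ip V p k" "r = k q"
    by metis
  then have "is_reproducing_kernel ip V (K(p := k)) \<and> r = (K(p := k)) p q"
    by (auto simp: is_reproducing_kernel_def represents_eval_def)
  then show "\<exists>K. is_reproducing_kernel ip V K \<and> r = K p q" by blast
qed

text \<open>The representer moves from \<open>\<rho>\<close> to \<open>\<sigma>\<close> and each
  test function \<open>g\<close> moves back to some \<open>f\<close>; inner products and the values
  at the two matching points are preserved.\<close>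

lemma represents_eval_same_profile:
  fixes \<rho> \<sigma> \<beta> \<gamma> \<mu> :: real and x :: "real ^ 'd"
  assumes nonneg: "\<rho> \<ge> 0" "\<sigma> \<ge> 0"
    and k: "represents_eval (inner_W \<rho> \<beta> \<gamma> \<mu>) (V_even n \<rho> \<beta> \<gamma> \<mu>) (x, t) k"
    and ts: "t\<^sup>2 - \<rho>\<^sup>2 = s\<^sup>2 - \<sigma>\<^sup>2"
  obtains k' where "represents_eval (inner_W \<sigma> \<beta> \<gamma> \<mu>) (V_even n \<sigma> \<beta> \<gamma> \<mu>) (x, s) k'" "same_profile \<rho> \<sigma> k k'"
proof -
  have kV: "k \<in> V_even n \<rho> \<beta> \<gamma> \<mu>"
    using k by (simp add: represents_eval_def)
  obtain k' where k': "k' \<in> V_even n \<sigma> \<beta> \<gamma> \<mu>" "same_profile \<rho> \<sigma> k k'"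
    using V_even_same_profile[OF nonneg kV] by metis
  have "inner_W \<sigma> \<beta> \<gamma> \<mu> g k' = g (x, s)" if g: "g \<in> V_even n \<sigma> \<beta> \<gamma> \<mu>" for g
  proof -
    obtain f where f: "f \<in> V_even n \<rho> \<beta> \<gamma> \<mu>" "same_profile \<sigma> \<rho> g f"
      using V_even_same_profile[OF nonneg(2,1) g] by metis
    have "inner_W \<sigma> \<beta> \<gamma> \<mu> g k' = inner_W \<rho> \<beta> \<gamma> \<mu> f k"
      using nonneg f g k' kV
      by (intro inner_W_same_profile) (auto simp: V_even_iff same_profile_sym[of \<sigma>] intro: continuous_on_poly_deg_le)
    also have "\<dots> = f (x, t)"
      using k f by (simp add: represents_eval_def)
    also have "\<dots> = g (x, s)"
      using f(2) ts[symmetric] by (simp add: same_profile_def)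
    finally show ?thesis .
  qed
  with k' show thesis
    by (intro that[of k']) (simp_all add: represents_eval_def)
qed

text \<open>
  The substitution \<open>t\<^sup>2 - \<rho>\<^sup>2 = s\<^sup>2 - \<sigma>\<^sup>2\<close> does not reach points with \<open>s\<^sup>2 < \<sigma>\<^sup>2 - \<rho>\<^sup>2\<close>; there the evaluation
  functional is a combination of evaluations at points \<open>(x, w)\<close> with \<open>w \<ge> \<sigma>\<close>.
\<close>

lemma all_evals_represented_transfer:
  fixes \<rho> \<sigma> \<beta> \<gamma> \<mu> :: real
  assumes nonneg: "\<rho> \<ge> 0" "\<sigma> \<ge> 0"
    and all: "\<And>p :: (real ^ 'd) \<times> real. \<exists>k. represents_eval (inner_W \<rho> \<beta> \<gamma> \<mu>) (V_even n \<rho> \<beta> \<gamma> \<mu>) p k"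
  shows "\<exists>k. represents_eval (inner_W \<sigma> \<beta> \<gamma> \<mu>) (V_even n \<sigma> \<beta> \<gamma> \<mu>) (p :: (real ^ 'd) \<times> real) k"
proof -
  obtain x s where p: "p = (x, s)" by (cases p)
  obtain l T where T: "\<forall>w\<in>T. \<sigma> \<le> w"
    and l: "\<And>f x. f \<in> poly_deg_le n \<Longrightarrow> f (x :: real ^ 'd, s) = (\<Sum>w\<in>T. l w * f (x, w))"
    using poly_deg_le_extrapolation[where r = \<sigma> and t = s and n = n] by metis
  have "\<exists>k. represents_eval (inner_W \<sigma> \<beta> \<gamma> \<mu>) (V_even n \<sigma> \<beta> \<gamma> \<mu>) (x, w) k" if "w \<in> T" for w
  proof -
    have "\<sigma>\<^sup>2 \<le> w\<^sup>2"
      using T that nonneg by (intro power_mono) auto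
    \<comment> \<open>The root is the height for \<open>\<rho>\<close> that matches
      \<open>w\<close>; it is real because \<open>w \<ge> \<sigma>\<close>.\<close>
    then have "(sqrt (w\<^sup>2 - \<sigma>\<^sup>2 + \<rho>\<^sup>2))\<^sup>2 - \<rho>\<^sup>2 = w\<^sup>2 - \<sigma>\<^sup>2" by simp
    then show ?thesis
      using all represents_eval_same_profile[OF nonneg] by metis
  qed
  then obtain k where k: "\<And>w. w \<in> T \<Longrightarrow> represents_eval (inner_W \<sigma> \<beta> \<gamma> \<mu>) (V_even n \<sigma> \<beta> \<gamma> \<mu>) (x, w) (k w)"
    by metis
  have kV: "k w \<in> V_even n \<sigma> \<beta> \<gamma> \<mu>" if "w \<in> T" for w
    using k[OF that] by (simp add: represents_eval_def)
  \<comment> \<open>By linearity, the combination of evaluations at the nodes is represented by the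
    same combination of representers.\<close>
  have "represents_eval (inner_W \<sigma> \<beta> \<gamma> \<mu>) (V_even n \<sigma> \<beta> \<gamma> \<mu>) p (\<lambda>q. \<Sum>w\<in>T. l w * k w q)"
    unfolding represents_eval_def
  proof (intro conjI ballI V_even_sum kV)
    fix f :: "(real ^ 'd) \<times> real \<Rightarrow> real" assume f: "f \<in> V_even n \<sigma> \<beta> \<gamma> \<mu>"
    have "inner_W \<sigma> \<beta> \<gamma> \<mu> f (\<lambda>q. \<Sum>w\<in>T. l w * k w q) = (\<Sum>w\<in>T. l w * inner_W \<sigma> \<beta> \<gamma> \<mu> (k w) f)"
      using kV f by (subst inner_W_commute, intro inner_W_sum_left)
        (auto simp: V_even_iff intro: continuous_on_poly_deg_le)
    also have "\<dots> = (\<Sum>w\<in>T. l w * f (x, w))"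
      using k f by (intro sum.cong refl) (simp add: represents_eval_def inner_W_commute[of _ _ _ _ _ f])
    also have "\<dots> = f p"
      using f by (simp add: p V_even_iff l[symmetric])
    finally show "inner_W \<sigma> \<beta> \<gamma> \<mu> f (\<lambda>q. \<Sum>w\<in>T. l w * k w q) = f p" .
  qed
  then show ?thesis by blast
qed

text \<open>The section at \<open>(x, t)\<close> moves with its profile, which preserves the value
  in question; the remaining sections only have to exist.\<close>

lemma ex_kernel_even_value_transfer:
  fixes \<rho> \<sigma> \<beta> \<gamma> \<mu> :: real and x y :: "real ^ 'd"
  assumes nonneg: "\<rho> \<ge> 0" "\<sigma> \<ge> 0"
    and eq: "t\<^sup>2 - \<rho>\<^sup>2 = t'\<^sup>2 - \<sigma>\<^sup>2" "s\<^sup>2 - \<rho>\<^sup>2 = s'\<^sup>2 - \<sigma>\<^sup>2"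
    and K: "\<exists>K. is_reproducing_kernel (inner_W \<rho> \<beta> \<gamma> \<mu>) (V_even n \<rho> \<beta> \<gamma> \<mu>) K \<and> r = K (x, t) (y, s)"
  shows "\<exists>K. is_reproducing_kernel (inner_W \<sigma> \<beta> \<gamma> \<mu>) (V_even n \<sigma> \<beta> \<gamma> \<mu>) K \<and> r = K (x, t') (y, s')"
proof -
  have all: "\<exists>k. represents_eval (inner_W \<rho> \<beta> \<gamma> \<mu>) (V_even n \<rho> \<beta> \<gamma> \<mu>) p k" for p :: "(real ^ 'd) \<times> real"
    using K unfolding ex_reproducing_kernel_value_iff by blast
  obtain k where k: "represents_eval (inner_W \<rho> \<beta> \<gamma> \<mu>) (V_even n \<rho> \<beta> \<gamma> \<mu>) (x, t) k" "r = k (y, s)"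
    using K unfolding ex_reproducing_kernel_value_iff by blast
  obtain k' where "represents_eval (inner_W \<sigma> \<beta> \<gamma> \<mu>) (V_even n \<sigma> \<beta> \<gamma> \<mu>) (x, t') k'" "same_profile \<rho> \<sigma> k k'"
    using represents_eval_same_profile[OF nonneg k(1) eq(1)] by metis
  moreover from this have "r = k' (y, s')"
    using k(2) eq(2) by (simp add: same_profile_def)
  ultimately show ?thesis
    unfolding ex_reproducing_kernel_value_iff using all_evals_represented_transfer[OF nonneg all] by blast
qed

theorem proposition5p7:
  fixes \<rho> \<beta> \<gamma> \<mu> t s :: real and x y :: "real ^ 'd" and n :: nat
  assumes "\<rho> > 0" and "\<beta> > - 1/2" and "\<gamma> > - 1/2" and "\<mu> > - 1/2"
    and "(x, t) \<in> solid_hyperboloid \<rho>" and "(y, s) \<in> solid_hyperboloid \<rho>"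
  shows "kernel_even n \<rho> \<beta> \<gamma> \<mu> (x, t) (y, s) =
    kernel_even n 0 \<beta> \<gamma> \<mu> (x, sqrt (t\<^sup>2 - \<rho>\<^sup>2)) (y, sqrt (s\<^sup>2 - \<rho>\<^sup>2))"
proof -
  have "0 \<le> u\<^sup>2 - \<rho>\<^sup>2" if "(z, u) \<in> solid_hyperboloid \<rho>" for z :: "real ^ 'd" and u
    using that by (rule solid_hyperboloid_nonneg)
  then have eq: "t\<^sup>2 - \<rho>\<^sup>2 = (sqrt (t\<^sup>2 - \<rho>\<^sup>2))\<^sup>2 - 0\<^sup>2" "s\<^sup>2 - \<rho>\<^sup>2 = (sqrt (s\<^sup>2 - \<rho>\<^sup>2))\<^sup>2 - 0\<^sup>2"
    using assms by fastforce+
  have "\<rho> \<ge> 0" using assms by simp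
  \<comment> \<open>The transfers from \<open>\<rho>\<close> to 0 and back give the two
    implications, so the predicates under \<open>THE\<close> are equal.\<close>
  show ?thesis
    unfolding kernel_even_def
    using ex_kernel_even_value_transfer[OF \<open>\<rho> \<ge> 0\<close> order_refl eq]
      ex_kernel_even_value_transfer[OF order_refl \<open>\<rho> \<ge> 0\<close> eq[symmetric]]
    by (intro arg_cong[of _ _ The] ext iffI)
qed

end
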